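(* Fix a square with side length $L>0$ and center $(X_0,Y_0)$. For every real $m>1$, the pole $(X_{eye},Y_{eye})$ of the $m$-spiral having this square as first square lies on the circle circumscribed around this square, i.e. $$(X_{eye}-X_0)^2+(Y_{eye}-Y_0)^2=\frac{L^2}{2},$$ where the circle does not depend on $m$.
   Context: Let $m>1$ be real, $L>0$ and $(X_0,Y_0)\in\mathbb{R}^2$. The $m$-spiral (generalized whirling square spiral) with first square of side $L$ centered at $(X_0,Y_0)$ is given by a sequence of axis-parallel squares, the $i$-th square ($i\ge 0$) having side length $L_i=L/m^i$ and center $(X_i,Y_i)$, where the centers are placed clockwise by the recursion $$\begin{aligned} i\equiv 0 \pmod 4:&\quad X_{i+1}=X_i+\tfrac{L_i}{2}+\tfrac{L_i}{2m},\quad Y_{i+1}=Y_i+\tfrac{L_i}{2}-\tfrac{L_i}{2m};\\ i\equiv 1 \pmod 4:&\quad X_{i+1}=X_i+\tfrac{L_i}{2}-\tfrac{L_i}{2m},\quad Y_{i+1}=Y_i-\tfrac{L_i}{2}-\tfrac{L_i}{2m};\\ i\equiv 2 \pmod 4:&\quad X_{i+1}=X_i-\tfrac{L_i}{2}-\tfrac{L_i}{2m},\quad Y_{i+1}=Y_i-\tfrac{L_i}{2}+\tfrac{L_i}{2m};\\ i\equiv 3 \pmod 4:&\quad X_{i+1}=X_i-\tfrac{L_i}{2}+\tfrac{L_i}{2m},\quad Y_{i+1}=Y_i+\tfrac{L_i}{2}+\tfrac{L_i}{2m}.\end{aligned}$$ The pole $(X_{eye},Y_{eye})$ of the $m$-spiral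 is the limit of the square centers $(X_i,Y_i)$ as $i\to\infty$. *)

theory Defs
  imports "HOL-Analysis.Analysis"
begin

definition spiral_side :: "real \<Rightarrow> real \<Rightarrow> nat \<Rightarrow> real" where
  "spiral_side L m i = L / m ^ i"

primrec spiral_center :: "real \<Rightarrow> real \<Rightarrow> real \<times> real \<Rightarrow> nat \<Rightarrow> real \<times> real" where
  "spiral_center L m c 0 = c"
| "spiral_center L m c (Suc i) =
    (let s = spiral_side L m i; X = fst (spiral_center L m c i); Y = snd (spiral_center L m c i)
     in if i mod 4 = 0 then (X + s / 2 + s / (2 * m), Y + s / 2 - s / (2 * m))
        else if i mod 4 = 1 then (X + s / 2 - s / (2 * m), Y - s / 2 - s / (2 * m))
        else if i mod 4 = 2 then (X - s / 2 - s / (2 * m), Y - s / 2 + s / (2 * m))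
        else (X - s / 2 + s / (2 * m), Y + s / 2 + s / (2 * m)))"

(* lim is a total function, so this is meaningful only together with convergence of the centers. *)
definition spiral_pole :: "real \<Rightarrow> real \<Rightarrow> real \<times> real \<Rightarrow> real \<times> real" where
  "spiral_pole L m c = lim (spiral_center L m c)"

definition square_vertices :: "real \<Rightarrow> real \<times> real \<Rightarrow> (real \<times> real) set" where
  "square_vertices s c = {fst c - s / 2, fst c + s / 2} \<times> {snd c - s / 2, snd c + s / 2}"

(* The metric on real \<times> real is the Euclidean one, so sphere is a genuine circle. *)
definition circumscribed_circle :: "(real \<times> real) set \<Rightarrow> real \<Rightarrow> real \<times> real \<Rightarrow> bool" where
  "circumscribed_circle C s c \<longleftrightarrow>
     (\<exists>p r. r > 0 \<and> C = sphere p r) \<and> square_vertices s c \<subseteq> C"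

end

theory Submission
  imports Defs
begin

text \<open>
  Identify the plane with \<open>\<complex>\<close> and put \<open>q = 1 / m\<close>. The step from the \<open>n\<close>-th centre to the next one
  is \<open>(L / 2) (1 + \<i>) (1 - \<i> q) (- \<i> q)^n\<close>: each step is the previous one turned clockwise by a
  right angle and shrunk by the factor \<open>q\<close> (\<open>spiral_center_step\<close>). The centres are therefore the
  partial sums of a geometric series of ratio \<open>- \<i> q\<close>, and the pole is
  \<open>(X\<^sub>0, Y\<^sub>0) + (L / 2) (1 + \<i>) \<cdot> (1 - \<i> q) / (1 + \<i> q)\<close>. The last quotient is a number divided by its
  conjugate, so it has modulus 1: as \<open>m\<close> varies, the vector from the centre of the square to the
  pole is always a rotated copy of the half-diagonal \<open>(L / 2) (1 + \<i>)\<close>.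
\<close>

text \<open>The point of \<open>\<real> \<times> \<real>\<close> regarded as a complex number.\<close>
definition plane_complex :: "real \<times> real \<Rightarrow> complex" where
  "plane_complex p = Complex (fst p) (snd p)"

text \<open>The vector from the first centre to the pole when \<open>m > 1\<close>, written so that its modulus is visible.\<close>
definition pole_offset :: "real \<Rightarrow> real \<Rightarrow> complex" where
  "pole_offset L m =
     of_real (L / 2) * (1 + \<i>) * ((1 - \<i> * of_real (1 / m)) / (1 + \<i> * of_real (1 / m)))"

lemma minus_ii_power_mod_4: "(- \<i>) ^ n = (- \<i>) ^ (n mod 4)"
proof -
  have "(- \<i>) ^ n = (- \<i>) ^ (4 * (n div 4) + n mod 4)"
    by simp
  also have "\<dots> = ((- \<i>) ^ 4) ^ (n div 4) * (- \<i>) ^ (n mod 4)"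
    by (simp only: power_add power_mult)
  also have "(- \<i>) ^ 4 = 1"
    by (simp add: power4_eq_xxxx)
  finally show ?thesis
    by simp
qed

lemma spiral_center_step:
  "plane_complex (spiral_center L m c (Suc n)) = plane_complex (spiral_center L m c n) +
     of_real (L / 2) * (1 + \<i>) * (1 - \<i> * of_real (1 / m)) * (- \<i> * of_real (1 / m)) ^ n"
proof -
  define s where "s = L / m ^ n"
  have s: "of_real L * of_real (1 / m) ^ n = (of_real s :: complex)"
    by (simp add: s_def power_divide)
  have power: "(- \<i> * of_real (1 / m)) ^ n = (- \<i>) ^ (n mod 4) * of_real (1 / m) ^ n"
    by (subst minus_ii_power_mod_4[symmetric]) (rule power_mult_distrib)
  have "of_real (L / 2) * (1 + \<i>) * (1 - \<i> * of_real (1 / m)) * (- \<i> * of_real (1 / m)) ^ n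
      = (of_real L * of_real (1 / m) ^ n) / 2 * (1 + \<i>) * (1 - \<i> * of_real (1 / m)) * (- \<i>) ^ (n mod 4)"
    unfolding power by simp
  also have "\<dots> = of_real (s / 2) * Complex (1 + 1 / m) (1 - 1 / m) * (- \<i>) ^ (n mod 4)"
    unfolding s by (simp add: complex_eq_iff field_simps)
  finally have step: "of_real (L / 2) * (1 + \<i>) * (1 - \<i> * of_real (1 / m)) * (- \<i> * of_real (1 / m)) ^ n
      = of_real (s / 2) * Complex (1 + 1 / m) (1 - 1 / m) * (- \<i>) ^ (n mod 4)" .
  have "n mod 4 < 4"
    by simp
  then consider "n mod 4 = 0" | "n mod 4 = 1" | "n mod 4 = 2" | "n mod 4 = 3"
    by linarith
  then show ?thesis
    unfolding step
    by cases (simp_all add: plane_complex_def spiral_side_def s_def [symmetric] Let_def complex_eq_iff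
        power2_eq_square power3_eq_cube algebra_simps add_divide_distrib diff_divide_distrib)
qed

lemma one_plus_ii_of_real_nonzero: "1 + \<i> * of_real q \<noteq> 0"
  by (simp add: complex_eq_iff)

lemma plane_complex_spiral_center:
  "plane_complex (spiral_center L m c n) =
     plane_complex c + pole_offset L m * (1 - (- \<i> * of_real (1 / m)) ^ n)"
proof (induction n)
  case 0
  show ?case
    by simp
next
  case (Suc n)
  have "of_real (L / 2) * (1 + \<i>) * (1 - \<i> * of_real (1 / m))
      = pole_offset L m * (1 + \<i> * of_real (1 / m))"
    by (simp only: pole_offset_def times_divide_eq_right times_divide_eq_left
        nonzero_mult_div_cancel_right[OF one_plus_ii_of_real_nonzero])
  then show ?case
    by (simp only: spiral_center_step Suc.IH) (simp add: algebra_simps)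
qed

lemma norm_pole_offset:
  assumes "L > 0"
  shows "norm (pole_offset L m) = L / sqrt 2"
proof -
  have "cnj (1 + \<i> * of_real (1 / m)) = 1 - \<i> * of_real (1 / m)"
    by simp
  then have "norm (1 - \<i> * of_real (1 / m)) = norm (1 + \<i> * of_real (1 / m))"
    by (metis complex_mod_cnj)
  then have "norm ((1 - \<i> * of_real (1 / m)) / (1 + \<i> * of_real (1 / m))) = 1"
    using one_plus_ii_of_real_nonzero[of "1 / m"] by (simp only: norm_divide) simp
  moreover have "norm (1 + \<i>) = sqrt 2"
    by (simp add: cmod_def)
  ultimately show ?thesis
    using assms by (simp only: pole_offset_def norm_mult) (simp add: real_div_sqrt field_simps)
qed

lemma spiral_center_tendsto:
  assumes "m > 1"
  shows "spiral_center L m c \<longlonglongrightarrow> (fst c + Re (pole_offset L m), snd c + Im (pole_offset L m))"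
proof -
  have "norm (- \<i> * of_real (1 / m)) < 1"
    using assms by (simp add: norm_mult norm_divide)
  then have "(\<lambda>n. (- \<i> * of_real (1 / m)) ^ n) \<longlonglongrightarrow> 0"
    by (rule LIMSEQ_power_zero)
  then have "(\<lambda>n. plane_complex c + pole_offset L m * (1 - (- \<i> * of_real (1 / m)) ^ n))
      \<longlonglongrightarrow> plane_complex c + pole_offset L m * (1 - 0)"
    by (intro tendsto_add tendsto_mult tendsto_diff tendsto_const)
  then have lim: "(\<lambda>n. plane_complex (spiral_center L m c n)) \<longlonglongrightarrow> plane_complex c + pole_offset L m"
    by (simp only: plane_complex_spiral_center) simp
  show ?thesis
    using tendsto_Pair[OF tendsto_Re[OF lim] tendsto_Im[OF lim]]
    by (simp add: plane_complex_def)
qed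

lemma circumscribed_circle_sphere:
  assumes "s > 0"
  shows "circumscribed_circle (sphere c (s / sqrt 2)) s c"
proof -
  have "sqrt ((s / 2)\<^sup>2 + (s / 2)\<^sup>2) = s / sqrt 2"
    using assms by (intro real_sqrt_unique) (simp_all add: power_divide)
  then have "square_vertices s c \<subseteq> sphere c (s / sqrt 2)"
    by (auto simp: square_vertices_def dist_prod_def dist_real_def power_divide)
  moreover have "s / sqrt 2 > 0"
    using assms by simp
  ultimately show ?thesis
    unfolding circumscribed_circle_def by blast
qed

theorem corollary2p7:
  fixes L X0 Y0 :: real
  assumes "L > 0"
  shows "\<exists>C. circumscribed_circle C L (X0, Y0) \<and>
    (\<forall>m>1. spiral_center L m (X0, Y0) \<longlonglongrightarrow> spiral_pole L m (X0, Y0) \<and>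
       spiral_pole L m (X0, Y0) \<in> C \<and>
       (fst (spiral_pole L m (X0, Y0)) - X0)\<^sup>2 + (snd (spiral_pole L m (X0, Y0)) - Y0)\<^sup>2 = L\<^sup>2 / 2)"
proof (intro exI conjI allI impI)
  show "circumscribed_circle (sphere (X0, Y0) (L / sqrt 2)) L (X0, Y0)"
    using assms by (rule circumscribed_circle_sphere)
next
  fix m :: real
  assume m: "m > 1"
  let ?w = "pole_offset L m"
  have lim: "spiral_center L m (X0, Y0) \<longlonglongrightarrow> (X0 + Re ?w, Y0 + Im ?w)"
    using spiral_center_tendsto[OF m, of L "(X0, Y0)"] by simp
  then have pole: "spiral_pole L m (X0, Y0) = (X0 + Re ?w, Y0 + Im ?w)"
    unfolding spiral_pole_def by (rule limI)
  show "spiral_center L m (X0, Y0) \<longlonglongrightarrow> spiral_pole L m (X0, Y0)"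
    using lim by (simp only: pole)
  have norm_w: "sqrt ((Re ?w)\<^sup>2 + (Im ?w)\<^sup>2) = L / sqrt 2"
    using norm_pole_offset[OF assms] by (simp add: cmod_def)
  then show "spiral_pole L m (X0, Y0) \<in> sphere (X0, Y0) (L / sqrt 2)"
    by (simp add: pole dist_prod_def dist_real_def)
  have "(Re ?w)\<^sup>2 + (Im ?w)\<^sup>2 = (L / sqrt 2)\<^sup>2"
    by (simp add: norm_w[symmetric])
  then show "(fst (spiral_pole L m (X0, Y0)) - X0)\<^sup>2 + (snd (spiral_pole L m (X0, Y0)) - Y0)\<^sup>2 = L\<^sup>2 / 2"
    by (simp add: pole power_divide)
qed

end
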